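(* Let $(\mathcal{P},\leq,\Omega)$ be a poset with a flow, and let $(\mathcal{Q},\leq)$ be a poset with a zero element and a join-dense subset $B\subset\mathcal{Q}$. For any order-preserving maps $\mathbf{F},\mathbf{G}:(\mathcal{P},\leq)\to(\mathcal{Q},\leq)$, $$d_{\mathrm{I}}(\mathbf{F},\mathbf{G})=\sup_{b\in B}d_{\mathrm{I}}(\mathbf{F}_b,\mathbf{G}_b),$$ where $\mathbf{F}_b,\mathbf{G}_b$ are the $b$-parts of $\mathbf{F},\mathbf{G}$.
   Context: Posets are nonempty. A (strict) flow on a poset $\mathcal{P}$ is a family $\Omega=\{\Omega_\varepsilon:\mathcal{P}\to\mathcal{P}\}_{\varepsilon\in[0,\infty)}$ of order-preserving maps such that $\Omega_s\leq\Omega_t$ pointwise for $s\leq t$, $\Omega_t\Omega_s=\Omega_{t+s}$ for all $s,t\in[0,\infty)$, and $\Omega_0=\mathrm{id}_{\mathcal{P}}$. Order-preserving maps $\mathbf{F},\mathbf{G}:\mathcal{P}\to\mathcal{Q}$ are $\varepsilon$-interleaved if $\mathbf{F}(p)\leq\mathbf{G}(\Omega_\varepsilon(p))$ and $\mathbf{G}(p)\leq\mathbf{F}(\Omega_\varepsilon(p))$ for all $p\in\mathcal{P}$; $d_{\mathrm{I}}(\mathbf{F},\mathbf{G})\in[0,\infty]$ is the infimum of all $\varepsilon\in[0,\infty)$ such that $\mathbf{F},\mathbf{G}$ are $\varepsilon$-interleaved ($\infty$ if there is none). A zero element of $\mathcal{Q}$ is an element $0$ with $0\leq q$ for all $q\in\mathcal{Q}$.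 A subset $B\subset\mathcal{Q}$ is join-dense if every element of $\mathcal{Q}$ is the join (least upper bound) of some subset of $B$ (the join of the empty set is the zero element). For $b\in\mathcal{Q}$, $b^\uparrow:=\{q\in\mathcal{Q}:b\leq q\}$. The $b$-part $\mathbf{F}_b:\mathcal{P}\to\mathcal{Q}$ of $\mathbf{F}$ is the order-preserving map with $\mathbf{F}_b(p)=b$ if $p\in\mathbf{F}^{-1}(b^\uparrow)$ (i.e. $b\leq\mathbf{F}(p)$) and $\mathbf{F}_b(p)=0$ otherwise. Suprema are taken in $[0,\infty]$. *)

theory Defs
  imports "HOL-Library.Lub_Glb" "HOL-Library.Extended_Nonnegative_Real"
begin

text \<open>
  Posets are types of class \<^class>\<open>order\<close> (nonempty, as every type is); a poset with a zero
  element is a type of class \<^class>\<open>order_bot\<close>, the zero element being \<^term>\<open>bot\<close>.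
\<close>

text \<open>
  The index set of a flow is \<open>[0,\<infinity>)\<close>, so nothing is required of
  \<open>\<Omega> \<epsilon>\<close> for negative \<open>\<epsilon>\<close>.
\<close>

definition flow :: "(real \<Rightarrow> 'p::order \<Rightarrow> 'p) \<Rightarrow> bool" where
  "flow \<Omega> \<longleftrightarrow>
     (\<forall>\<epsilon>\<ge>0. mono (\<Omega> \<epsilon>)) \<and>
     (\<forall>s\<ge>0. \<forall>t\<ge>s. \<forall>p. \<Omega> s p \<le> \<Omega> t p) \<and>
     (\<forall>s\<ge>0. \<forall>t\<ge>0. \<Omega> t \<circ> \<Omega> s = \<Omega> (t + s)) \<and>
     \<Omega> 0 = id"

definition interleaved ::
  "(real \<Rightarrow> 'p::order \<Rightarrow> 'p) \<Rightarrow> real \<Rightarrow> ('p \<Rightarrow> 'q::order) \<Rightarrow> ('p \<Rightarrow> 'q) \<Rightarrow> bool" where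
  "interleaved \<Omega> \<epsilon> F G \<longleftrightarrow>
     (\<forall>p. F p \<le> G (\<Omega> \<epsilon> p)) \<and> (\<forall>p. G p \<le> F (\<Omega> \<epsilon> p))"

text \<open>The infimum is taken in \<open>[0,\<infinity>]\<close>, where the infimum of the empty set is \<open>\<infinity>\<close>.\<close>

definition interleaving_dist ::
  "(real \<Rightarrow> 'p::order \<Rightarrow> 'p) \<Rightarrow> ('p \<Rightarrow> 'q::order) \<Rightarrow> ('p \<Rightarrow> 'q) \<Rightarrow> ennreal" where
  "interleaving_dist \<Omega> F G = Inf {ennreal \<epsilon> | \<epsilon>. 0 \<le> \<epsilon> \<and> interleaved \<Omega> \<epsilon> F G}"

definition join_dense :: "'q::order set \<Rightarrow> bool" where
  "join_dense B \<longleftrightarrow> (\<forall>q. \<exists>A\<subseteq>B. isLub UNIV A q)"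

definition part :: "'q::order_bot \<Rightarrow> ('p \<Rightarrow> 'q) \<Rightarrow> 'p \<Rightarrow> 'q" where
  "part b F p = (if p \<in> F -` {b..} then b else bot)"

end

theory Submission
  imports Defs
begin

text \<open>
  A join-dense set \<open>B\<close> detects the order: \<open>x \<le> y\<close> holds as soon as every element of \<open>B\<close> below \<open>x\<close>
  is below \<open>y\<close>, because \<open>x\<close> is the join of such elements. On the other hand, comparing values of
  two \<open>b\<close>-parts is the same as comparing membership in the principal up-set of \<open>b\<close>. Hence \<open>F\<close> and
  \<open>G\<close> are \<open>\<epsilon>\<close>-interleaved exactly when all their \<open>b\<close>-parts are, for one and the same \<open>\<epsilon>\<close>
  (\<open>interleaved_iff_interleaved_parts\<close>).

  This equivalence makes every distance between \<open>b\<close>-parts at most the distance between \<open>F\<close> and \<open>G\<close>.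
  For the other inequality, the parameters that witness small distances may depend on \<open>b\<close>; but
  along a flow an interleaving persists for larger parameters, so any real number above the supremum
  is a common parameter for all \<open>b\<close>, and the equivalence applies to it.
\<close>

lemma join_dense_le_iff:
  assumes "join_dense B"
  shows "x \<le> y \<longleftrightarrow> (\<forall>b\<in>B. b \<le> x \<longrightarrow> b \<le> y)"
proof
  assume below: "\<forall>b\<in>B. b \<le> x \<longrightarrow> b \<le> y"
  obtain A where "A \<subseteq> B" and lub: "isLub UNIV A x"
    using assms by (auto simp: join_dense_def)
  have "b \<le> y" if "b \<in> A" for b
    using that \<open>A \<subseteq> B\<close> below isLubD2[OF lub] by blast
  then have "isUb UNIV A y"
    by (auto intro: isUbI setleI)
  then show "x \<le> y"
    by (rule isLub_le_isUb[OF lub])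
qed (blast intro: order_trans)

text \<open>If \<open>b\<close> is the zero element, both sides hold trivially; otherwise the values \<open>b\<close> and zero of a
  \<open>b\<close>-part encode truth and falsity of membership in the up-set.\<close>

lemma part_le_part_iff: "part b F p \<le> part b G q \<longleftrightarrow> (b \<le> F p \<longrightarrow> b \<le> G q)"
  by (auto simp: part_def bot_unique)

lemma interleaved_iff_interleaved_parts:
  fixes F G :: "'a::order \<Rightarrow> 'b::order_bot"
  assumes "join_dense B"
  shows "interleaved \<Omega> \<epsilon> F G \<longleftrightarrow> (\<forall>b\<in>B. interleaved \<Omega> \<epsilon> (part b F) (part b G))"
proof -
  have "F p \<le> G q \<longleftrightarrow> (\<forall>b\<in>B. part b F p \<le> part b G q)" for F G :: "'a \<Rightarrow> 'b" and p q
    unfolding part_le_part_iff by (rule join_dense_le_iff[OF assms])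
  then show ?thesis
    unfolding interleaved_def by blast
qed

lemma mono_part:
  assumes "mono F"
  shows "mono (part b F)"
  unfolding mono_def part_le_part_iff using assms by (blast intro: order_trans dest: monoD)

lemma interleaved_mono:
  assumes "flow \<Omega>" "mono F" "mono G" "0 \<le> s" "s \<le> t" "interleaved \<Omega> s F G"
  shows "interleaved \<Omega> t F G"
proof -
  have "\<Omega> s p \<le> \<Omega> t p" for p
    using assms(1,4,5) by (simp add: flow_def)
  then show ?thesis
    using assms(2,3,6) unfolding interleaved_def by (meson monoD order_trans)
qed

lemma interleaving_dist_le:
  assumes "0 \<le> \<epsilon>" "interleaved \<Omega> \<epsilon> F G"
  shows "interleaving_dist \<Omega> F G \<le> ennreal \<epsilon>"
  unfolding interleaving_dist_def using assms by (auto intro: Inf_lower)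

text \<open>The infimum need not be attained, but every parameter strictly above it is a witness.\<close>

lemma interleaved_if_dist_less:
  assumes "flow \<Omega>" "mono F" "mono G" "0 \<le> t" "interleaving_dist \<Omega> F G < ennreal t"
  shows "interleaved \<Omega> t F G"
proof -
  obtain s where "0 \<le> s" "interleaved \<Omega> s F G" "ennreal s < ennreal t"
    using assms(5) by (auto simp: interleaving_dist_def Inf_less_iff)
  then show ?thesis
    using assms(1-4) by (auto intro: interleaved_mono simp: ennreal_less_iff)
qed

theorem theorem3p7:
  fixes \<Omega> :: "real \<Rightarrow> 'p::order \<Rightarrow> 'p"
    and B :: "'q::order_bot set"
    and F G :: "'p \<Rightarrow> 'q"
  assumes "flow \<Omega>"
    and "join_dense B"
    and "mono F" and "mono G"
  shows "interleaving_dist \<Omega> F G = (SUP b\<in>B. interleaving_dist \<Omega> (part b F) (part b G))"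
    (is "_ = ?S")
proof (rule antisym)
  show "interleaving_dist \<Omega> F G \<le> ?S"
  proof (rule dense_ge)
    fix x assume "?S < x"
    show "interleaving_dist \<Omega> F G \<le> x"
    proof (cases x)
      case (real t)
      have "interleaved \<Omega> t (part b F) (part b G)" if "b \<in> B" for b
      proof (rule interleaved_if_dist_less)
        show "interleaving_dist \<Omega> (part b F) (part b G) < ennreal t"
          using SUP_lessD[OF \<open>?S < x\<close> that] real by simp
      qed (use assms real in \<open>auto intro: mono_part\<close>)
      then have "interleaved \<Omega> t F G"
        using interleaved_iff_interleaved_parts[OF assms(2)] by blast
      then show ?thesis
        using real by (simp add: interleaving_dist_le)
    qed simp
  qed
  show "?S \<le> interleaving_dist \<Omega> F G"
  proof (rule SUP_least)
    fix b assume "b \<in> B"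
    then show "interleaving_dist \<Omega> (part b F) (part b G) \<le> interleaving_dist \<Omega> F G"
      unfolding interleaving_dist_def
      using interleaved_iff_interleaved_parts[OF assms(2)] by (intro Inf_superset_mono) blast
  qed
qed

end
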